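(* Let $0 < \varepsilon < \frac{1}{100}$. There is an $n_0 = n_0(\varepsilon)$ such that for every odd integer $n > n_0$ there is an $n$-vertex graph containing no $C_4$ that is $k$-regular for some integer $k \geq \left( \sqrt{1/6} - \varepsilon \right) n^{1/2}$.
   Context: Graphs are finite and simple; $C_4$ denotes the cycle of length $4$. *)

theory Defs
  imports Complex_Main
begin

definition simple_graph :: "'a set \<Rightarrow> 'a set set \<Rightarrow> bool" where
  "simple_graph V E \<longleftrightarrow> finite V \<and> (\<forall>e\<in>E. e \<subseteq> V \<and> card e = 2)"

definition degree :: "'a set set \<Rightarrow> 'a \<Rightarrow> nat" where
  "degree E v = card {e \<in> E. v \<in> e}"

definition regular_graph :: "'a set \<Rightarrow> 'a set set \<Rightarrow> nat \<Rightarrow> bool" where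
  "regular_graph V E k \<longleftrightarrow> (\<forall>v\<in>V. degree E v = k)"

(* The 4-cycle is a subgraph, not necessarily an induced one: the diagonals
   {a, c} and {b, d} may or may not be edges. *)
definition contains_C4 :: "'a set set \<Rightarrow> bool" where
  "contains_C4 E \<longleftrightarrow>
     (\<exists>a b c d. distinct [a, b, c, d] \<and>
        {a, b} \<in> E \<and> {b, c} \<in> E \<and> {c, d} \<in> E \<and> {d, a} \<in> E)"

end

(* A bipartite C4-free graph stays C4-free when a matching is added inside one colour class.
   For a set S of integers in [0, m/2) with distinct pairwise sums, joining x and y in two copies
   of Z/m whenever y - x lies in S gives a C4-free bipartite card S-regular graph. Deleting
   one vertex leaves 2m - 1 vertices, with degree deficit 1 at its card S neighbours, all on one
   side; if card S is even, a perfect matching on them restores regularity.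

   Ruzsa's sets have p - 1 elements below p (p - 1). With p close to sqrt (m/2) = sqrt n / 2 the
   degree would be about sqrt n / 2, which exceeds sqrt (n/6) by a factor sqrt (3/2) = 1.2247...
   So it suffices that primes p with x / 1.22 < p <= x exist for large x, and this is within reach
   of Chebyshev's estimates, whose upper and lower bounds differ by a factor 6/5. *)

theory Submission
  imports Defs "HOL-Real_Asymp.Real_Asymp" "HOL-Number_Theory.Number_Theory"
begin

section \<open>Sidon sets\<close>

definition sidon :: "nat set \<Rightarrow> bool" where
  "sidon S \<longleftrightarrow> (\<forall>a\<in>S. \<forall>b\<in>S. \<forall>c\<in>S. \<forall>d\<in>S. a + b = c + d \<longrightarrow> a = c \<or> a = d)"

lemma sidonD:
  "sidon S \<Longrightarrow> a \<in> S \<Longrightarrow> b \<in> S \<Longrightarrow> c \<in> S \<Longrightarrow> d \<in> S \<Longrightarrow> a + b = c + d \<Longrightarrow> a = c \<or> a = d"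
  unfolding sidon_def by blast

text \<open>Modulo \<open>p\<close>, \<open>(t - a) * (t - b)\<close> and
  \<open>(t - c) * (t - d)\<close> are the same polynomial in \<open>t\<close>, so \<open>a\<close>
  is a root of the second; a prime modulus leaves no zero divisors.\<close>

lemma prime_cong_sum_product_cases:
  fixes a b c d p :: int
  assumes "prime p" and sum: "[a + b = c + d] (mod p)" and prd: "[a * b = c * d] (mod p)"
  shows "[a = c] (mod p) \<or> [a = d] (mod p)"
proof -
  have "(a - c) * (a - d) = a * (a + b - (c + d)) - (a * b - c * d)"
    by (simp add: algebra_simps)
  moreover have "p dvd a + b - (c + d)" "p dvd a * b - c * d"
    using sum prd by (simp_all add: cong_iff_dvd_diff)
  ultimately have "p dvd (a - c) * (a - d)"
    by simp
  then show ?thesis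
    using \<open>prime p\<close> by (simp add: prime_dvd_mult_iff cong_iff_dvd_diff)
qed

text \<open>Ruzsa's set: the residue modulo \<open>p * (p - 1)\<close> that is \<open>i\<close> modulo \<open>p - 1\<close> and \<open>g ^ i\<close>
  modulo \<open>p\<close>, for a primitive root \<open>g\<close>. A sum of two elements determines both the product
  (through the exponents) and the sum of the corresponding powers of \<open>g\<close>.\<close>

lemma sidon_set_exists:
  assumes "prime p"
  obtains S where "sidon S" "card S = p - 1" "S \<subseteq> {..<p * (p - 1)}"
proof -
  have p: "p > 1" by (rule prime_gt_1_nat[OF assms])
  obtain g where "residue_primroot p g"
    using prime_primitive_root_exists[OF _ assms] p by blast
  then have cop: "coprime p g" and ord: "ord p g = p - 1"
    using assms by (auto simp: residue_primroot_def totient_prime)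
  \<comment> \<open>Chinese remaindering: \<open>p\<close> is 1 modulo \<open>p - 1\<close> and 0
    modulo \<open>p\<close>, while \<open>(p - 1) * (p - 1)\<close> is 0 modulo \<open>p - 1\<close>
    and 1 modulo \<open>p\<close>.\<close>
  define r where "r i = (p * i + (p - 1) * (p - 1) * g ^ i) mod (p * (p - 1))" for i
  have r1: "[r i = i] (mod (p - 1))" for i
  proof -
    have "[r i = p * i + (p - 1) * (p - 1) * g ^ i] (mod (p - 1))"
      unfolding r_def by (simp add: cong_def mod_mod_cancel)
    also have "p * i + (p - 1) * (p - 1) * g ^ i = i + (p - 1) * (i + (p - 1) * g ^ i)"
      using p by (cases p) (auto simp: algebra_simps)
    also have "[\<dots> = i] (mod (p - 1))"
      by (simp add: cong_def)
    finally show ?thesis .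
  qed
  have r2: "[r i = g ^ i] (mod p)" for i
  proof -
    have "[r i = p * i + (p - 1) * (p - 1) * g ^ i] (mod p)"
      unfolding r_def by (simp add: cong_def mod_mod_cancel)
    also have "(p - 1) * (p - 1) = 1 + p * (p - 2)"
      using p by (cases p; cases "p - 1") (auto simp: algebra_simps)
    also have "p * i + (1 + p * (p - 2)) * g ^ i = g ^ i + p * (i + (p - 2) * g ^ i)"
      by (simp add: algebra_simps)
    also have "[\<dots> = g ^ i] (mod p)"
      by (simp add: cong_def)
    finally show ?thesis .
  qed
  have exp: "[g ^ i = g ^ j] (mod p) \<longleftrightarrow> [i = j] (mod (p - 1))" for i j
    using order_divides_expdiff[OF cop, of i j] ord by simp
  have r_eq: "i = j" if "[g ^ i = g ^ j] (mod p)" "i < p - 1" "j < p - 1" for i j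
    using that exp by (simp add: cong_def)
  have inj: "inj_on r {..<p - 1}"
  proof (rule inj_onI)
    fix i j assume "i \<in> {..<p - 1}" "j \<in> {..<p - 1}" "r i = r j"
    then show "i = j" using r1[of i] r1[of j] by (simp add: cong_def)
  qed
  have "sidon (r ` {..<p - 1})"
    unfolding sidon_def
  proof (clarify)
    fix a b c d
    assume *: "a < p - 1" "b < p - 1" "c < p - 1" "d < p - 1"
      and sum: "r a + r b = r c + r d" and neq: "r a \<noteq> r d"
    have "[a + b = r a + r b] (mod (p - 1))"
      by (intro cong_add cong_sym[OF r1])
    also have "[r a + r b = c + d] (mod (p - 1))"
      unfolding sum by (intro cong_add r1)
    finally have prd: "[g ^ a * g ^ b = g ^ c * g ^ d] (mod p)"
      by (simp add: exp flip: power_add)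
    have "[g ^ a + g ^ b = r a + r b] (mod p)"
      by (intro cong_add cong_sym[OF r2])
    also have "[r a + r b = g ^ c + g ^ d] (mod p)"
      unfolding sum by (intro cong_add r2)
    finally have sm: "[g ^ a + g ^ b = g ^ c + g ^ d] (mod p)" .
    \<comment> \<open>The argument with roots subtracts, hence the passage to integers.\<close>
    have "[int (g ^ a) = int (g ^ c)] (mod int p) \<or> [int (g ^ a) = int (g ^ d)] (mod int p)"
      using prd sm assms
      by (intro prime_cong_sum_product_cases[where b = "int (g ^ b)"])
         (simp_all only: cong_int_iff flip: of_nat_add of_nat_mult, simp_all)
    then have "[g ^ a = g ^ c] (mod p) \<or> [g ^ a = g ^ d] (mod p)"
      by (simp only: cong_int_iff)
    then have "a = c \<or> a = d"
      using r_eq * by blast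
    then show "r a = r c" using neq by auto
  qed
  moreover have "r ` {..<p - 1} \<subseteq> {..<p * (p - 1)}"
    using p by (auto simp: r_def)
  ultimately show ?thesis
    using that[of "r ` {..<p - 1}"] inj by (simp add: card_image)
qed

section \<open>The graph of a Sidon set\<close>

lemma even_card_perfect_matching:
  assumes "finite D" "even (card D)"
  shows "\<exists>M. (\<forall>e\<in>M. e \<subseteq> D \<and> card e = 2) \<and> (\<forall>v\<in>D. \<exists>!e. e \<in> M \<and> v \<in> e)"
  using assms
proof (induction "card D" arbitrary: D rule: less_induct)
  case less
  show ?case
  proof (cases "D = {}")
    case False
    then obtain a where a: "a \<in> D" by blast
    have "D - {a} \<noteq> {}"
    proof
      assume "D - {a} = {}"
      with a have "D = {a}" by blast
      with less.prems show False by simp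
    qed
    then obtain b where b: "b \<in> D" "b \<noteq> a" by blast
    define D' where "D' = D - {a, b}"
    have card: "card D = card D' + 2"
      using a b less.prems(1) card_mono[of D "{a,b}"] by (simp add: D'_def card_Diff_subset)
    obtain M where M: "\<forall>e\<in>M. e \<subseteq> D' \<and> card e = 2" "\<forall>v\<in>D'. \<exists>!e. e \<in> M \<and> v \<in> e"
      using less.hyps[of D'] less.prems card by (auto simp: D'_def)
    have cover: "\<exists>!e. e \<in> insert {a, b} M \<and> v \<in> e" if "v \<in> D" for v
    proof (cases "v \<in> D'")
      case True
      then have "v \<notin> {a, b}" by (auto simp: D'_def)
      moreover obtain e where "e \<in> M" "v \<in> e" "\<And>e'. e' \<in> M \<Longrightarrow> v \<in> e' \<Longrightarrow> e' = e"
        using bspec[OF M(2) True] by (elim ex1E conjE) blast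
      ultimately show ?thesis by (intro ex1I[of _ e]) blast+
    next
      case False
      then have "v \<in> {a, b}" using that by (auto simp: D'_def)
      then have "v \<notin> e" if "e \<in> M" for e
        using M(1) that by (auto simp: D'_def)
      then show ?thesis using \<open>v \<in> {a, b}\<close> by auto
    qed
    have "\<forall>e\<in>insert {a, b} M. e \<subseteq> D \<and> card e = 2"
      using M(1) a b by (auto simp: D'_def)
    moreover have "\<forall>v\<in>D. \<exists>!e. e \<in> insert {a, b} M \<and> v \<in> e"
      by (intro ballI cover)
    ultimately show ?thesis by (intro exI[of _ "insert {a, b} M"] conjI)
  qed auto
qed

text \<open>A 4-cycle has an even number of crossing edges, so if it meets \<open>M\<close> it has two edges in
  \<open>M\<close>; these would share a vertex.\<close>

lemma bipartite_Un_matching_no_C4: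
  assumes disj: "X \<inter> Y = {}"
    and E: "\<And>e. e \<in> E \<Longrightarrow> \<exists>x\<in>X. \<exists>y\<in>Y. e = {x, y}"
    and noC4: "\<And>x x' y y'. x \<in> X \<Longrightarrow> x' \<in> X \<Longrightarrow> y \<in> Y \<Longrightarrow> y' \<in> Y \<Longrightarrow> x \<noteq> x' \<Longrightarrow> y \<noteq> y' \<Longrightarrow>
      {x, y} \<in> E \<Longrightarrow> {x', y} \<in> E \<Longrightarrow> {x, y'} \<in> E \<Longrightarrow> {x', y'} \<in> E \<Longrightarrow> False"
    and M: "\<And>e. e \<in> M \<Longrightarrow> e \<subseteq> X"
    and matching: "\<And>e e' v. e \<in> M \<Longrightarrow> e' \<in> M \<Longrightarrow> v \<in> e \<Longrightarrow> v \<in> e' \<Longrightarrow> e = e'"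
  shows "\<not> contains_C4 (E \<union> M)"
proof
  assume "contains_C4 (E \<union> M)"
  then obtain a b c d where dist: "distinct [a, b, c, d]"
    and edges: "{a, b} \<in> E \<union> M" "{b, c} \<in> E \<union> M" "{c, d} \<in> E \<union> M" "{d, a} \<in> E \<union> M"
    unfolding contains_C4_def by blast
  have side: "u \<in> X \<and> v \<in> Y \<and> {u, v} \<in> E \<or> u \<in> Y \<and> v \<in> X \<and> {v, u} \<in> E \<or> u \<in> X \<and> v \<in> X \<and> {u, v} \<in> M"
    if "{u, v} \<in> E \<union> M" for u v
    using that E[of "{u, v}"] M[of "{u, v}"] by (auto simp: doubleton_eq_iff insert_commute)
  have meet: False if "{u, v} \<in> M" "{v, w} \<in> M" "u \<noteq> w" for u v w
    using matching[OF that(1,2), of v] that(3) by (auto simp: doubleton_eq_iff)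
  have XY: "\<And>v. v \<in> X \<Longrightarrow> v \<in> Y \<Longrightarrow> False" using disj by blast
  note s = side[OF edges(1)] side[OF edges(2)] side[OF edges(3)] side[OF edges(4)]
  have "\<not> (a \<in> X \<and> c \<in> X \<and> b \<in> Y \<and> d \<in> Y)"
    using noC4[of a c b d] s dist XY by auto
  moreover have "\<not> (a \<in> Y \<and> c \<in> Y \<and> b \<in> X \<and> d \<in> X)"
    using noC4[of b d a c] s dist XY by auto
  \<comment> \<open>No edge joins two vertices of \<open>Y\<close>, so at most one vertex of the
    cycle is left in \<open>Y\<close>; then some vertex of the cycle has both its cycle edges in
    \<open>M\<close>.\<close>
  ultimately show False
    using s dist XY meet[of a b c] meet[of b c d] meet[of c d a] meet[of d a b]
    by (elim disjE conjE) (simp_all, blast+)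
qed

lemma mod_eq_imp_eq_nat:
  fixes x y m :: nat
  assumes "x mod m = y mod m" "x < y + m" "y < x + m"
  shows "x = y"
proof -
  have "int m dvd int x - int y" using assms(1) by (metis mod_eq_dvd_iff of_nat_mod)
  moreover have "\<bar>int x - int y\<bar> < int m" using assms(2,3) by linarith
  ultimately have "int x - int y = 0" by (metis dvd_imp_le_int not_le abs_of_nat)
  then show ?thesis by simp
qed

text \<open>The bound \<open>2 * N \<le> m\<close> keeps sums of two elements of \<open>S\<close>
  below \<open>m\<close>, so the Sidon property survives modulo \<open>m\<close>. Evenness of
  \<open>card S\<close> allows a perfect matching on the neighbours of the deleted vertex.\<close>

theorem sidon_odd_regular_graph:
  assumes S: "sidon S" "S \<subseteq> {..<N}" and m: "2 * N \<le> m" "m > 0" and even: "even (card S)"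
  shows "\<exists>E. simple_graph {..<2 * m - 1} E \<and> \<not> contains_C4 E
    \<and> regular_graph {..<2 * m - 1} E (card S)"
proof -
  have fin: "finite S" using S(2) finite_subset by blast
  have less: "s < N" if "s \<in> S" for s using S(2) that by auto
  \<comment> \<open>The second copy of the residues, shifted by \<open>m\<close>, without its last
    vertex \<open>2 * m - 1\<close>.\<close>
  define Y where "Y = {m..<2 * m - 1}"
  define E where "E = {{x, y} | x y. x < m \<and> y \<in> Y \<and> (\<exists>s\<in>S. (x + s) mod m = y - m)}"
  \<comment> \<open>The neighbours that the deleted vertex would have: \<open>x + s = m - 1\<close>
    has no wrap-around, because \<open>s < m\<close>.\<close>
  define D where "D = (\<lambda>s. m - 1 - s) ` S"
  have inj: "inj_on (\<lambda>s. m - 1 - s) S"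
  proof (rule inj_onI)
    fix s t assume "s \<in> S" "t \<in> S" "m - 1 - s = m - 1 - t"
    then show "s = t" using less[of s] less[of t] m by linarith
  qed
  have card_D: "card D = card S" unfolding D_def by (rule card_image[OF inj])
  have D_sub: "D \<subseteq> {..<m}" using m by (auto simp: D_def)
  have "finite D" "even (card D)" using fin even card_D by (simp_all add: D_def)
  from even_card_perfect_matching[OF this] obtain M
    where M0: "\<forall>e\<in>M. e \<subseteq> D \<and> card e = 2" and M1: "\<forall>v\<in>D. \<exists>!e. e \<in> M \<and> v \<in> e"
    by (elim exE conjE)
  note M = bspec[OF M0] and M_unique = bspec[OF M1]
  have E_iff: "{x, y} \<in> E \<longleftrightarrow> (\<exists>s\<in>S. (x + s) mod m = y - m)" if "x < m" "y \<in> Y" for x y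
  proof -
    have "x' = x \<and> y' = y" if "{x, y} = {x', y'}" "x' < m" "y' \<in> Y" for x' y'
      using that \<open>x < m\<close> \<open>y \<in> Y\<close> by (auto simp: doubleton_eq_iff Y_def)
    moreover have "{x, y} \<in> E \<longleftrightarrow> (\<exists>x' y'. {x, y} = {x', y'} \<and> x' < m \<and> y' \<in> Y \<and>
        (\<exists>s\<in>S. (x' + s) mod m = y' - m))"
      by (simp only: E_def mem_Collect_eq)
    ultimately show ?thesis using that by metis
  qed
  have shift_inj: "s = t" if "s \<in> S" "t \<in> S" "(x + s) mod m = (x + t) mod m" for s t x
    using mod_eq_imp_eq_nat[OF that(3)] less[OF that(1)] less[OF that(2)] m by linarith
  have noC4: False
    if xy: "x < m" "x' < m" "y \<in> Y" "y' \<in> Y" "x \<noteq> x'" "y \<noteq> y'"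
      and e: "{x, y} \<in> E" "{x', y} \<in> E" "{x, y'} \<in> E" "{x', y'} \<in> E" for x x' y y'
  proof -
    obtain s1 s2 s3 s4 where s: "s1 \<in> S" "s2 \<in> S" "s3 \<in> S" "s4 \<in> S"
      and eq: "(x + s1) mod m = y - m" "(x' + s2) mod m = y - m"
        "(x + s3) mod m = y' - m" "(x' + s4) mod m = y' - m"
      using e E_iff xy by metis
    have "int m dvd (int x + int s1) - (int x' + int s2)"
         "int m dvd (int x + int s3) - (int x' + int s4)"
      using eq by (metis mod_eq_dvd_iff of_nat_add of_nat_mod)+
    \<comment> \<open>The alternating sum around the cycle cancels \<open>x\<close> and
      \<open>x'\<close> and leaves a relation within \<open>S\<close>.\<close>
    then have "int m dvd ((int x + int s1) - (int x' + int s2)) - ((int x + int s3) - (int x' + int s4))"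
      by (rule dvd_diff)
    then have "int m dvd (int s1 + int s4) - (int s2 + int s3)"
      by (simp add: algebra_simps)
    then have "int ((s1 + s4) mod m) = int ((s2 + s3) mod m)"
      by (simp add: of_nat_mod mod_eq_dvd_iff)
    then have "(s1 + s4) mod m = (s2 + s3) mod m"
      by (simp only: of_nat_eq_iff)
    then have "s1 + s4 = s2 + s3"
      by (rule mod_eq_imp_eq_nat)
        (use less[OF s(1)] less[OF s(2)] less[OF s(3)] less[OF s(4)] m in linarith)+
    then have "s1 = s2 \<or> s1 = s3"
      by (rule sidonD[OF S(1) s(1) s(4) s(2) s(3)])
    then show False
    proof
      assume "s1 = s2"
      then have "(x + s1) mod m = (x' + s1) mod m"
        using eq(1,2) by simp
      then have "x + s1 = x' + s1"
        by (rule mod_eq_imp_eq_nat) (use xy in linarith)+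
      with xy show False by simp
    next
      assume "s1 = s3"
      then have "y - m = y' - m" using eq by simp
      with xy show False by (auto simp: Y_def)
    qed
  qed
  have E_bip: "\<exists>x\<in>{..<m}. \<exists>y\<in>Y. e = {x, y}" if "e \<in> E" for e
    using that unfolding E_def by blast
  have "\<not> contains_C4 (E \<union> M)"
  proof (rule bipartite_Un_matching_no_C4[of "{..<m}" Y])
    fix e assume "e \<in> M" then show "e \<subseteq> {..<m}" using M D_sub by blast
  next
    fix e e' v assume "e \<in> M" "e' \<in> M" "v \<in> e" "v \<in> e'"
    then show "e = e'" using M[of e] M_unique[of v] by blast
  qed (use noC4 E_bip in \<open>auto simp: Y_def\<close>)
  moreover have "simple_graph {..<2 * m - 1} (E \<union> M)"
  proof -
    have "e \<subseteq> {..<2 * m - 1} \<and> card e = 2" if "e \<in> E" for e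
      using E_bip[OF that] m by (auto simp: Y_def)
    moreover have "e \<subseteq> {..<2 * m - 1} \<and> card e = 2" if "e \<in> M" for e
      using M[OF that] D_sub m by fastforce
    ultimately show ?thesis by (auto simp: simple_graph_def)
  qed
  moreover have "degree (E \<union> M) v = card S" if v: "v < 2 * m - 1" for v
  proof (cases "v < m")
    case True
    \<comment> \<open>The shifts whose edge at \<open>v\<close> does not lead to the deleted
      vertex.\<close>
    define T where "T = {s \<in> S. (v + s) mod m \<noteq> m - 1}"
    have E_deg: "{e \<in> E. v \<in> e} = (\<lambda>s. {v, m + (v + s) mod m}) ` T" (is "?L = ?R")
    proof
      show "?L \<subseteq> ?R"
      proof
        fix e assume "e \<in> ?L"
        then obtain y s where ys: "y \<in> Y" "s \<in> S" "(v + s) mod m = y - m" "e = {v, y}"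
          using True by (auto simp: E_def Y_def)
        have "s \<in> T" using ys(1-3) by (auto simp: T_def Y_def)
        moreover have "e = {v, m + (v + s) mod m}" using ys(1) by (simp add: ys(3,4) Y_def)
        ultimately show "e \<in> ?R" by blast
      qed
      show "?R \<subseteq> ?L"
      proof
        fix e assume "e \<in> ?R"
        then obtain s where s: "s \<in> S" "(v + s) mod m \<noteq> m - 1" "e = {v, m + (v + s) mod m}"
          by (auto simp: T_def)
        have "(v + s) mod m < m" using m by simp
        then have "m + (v + s) mod m \<in> Y" using s(2) by (auto simp: Y_def)
        then show "e \<in> ?L" using s E_iff[OF True] by auto
      qed
    qed
    have "inj_on (\<lambda>s. {v, m + (v + s) mod m}) T"
      using True shift_inj by (auto simp: inj_on_def doubleton_eq_iff T_def)
    then have E_card: "card {e \<in> E. v \<in> e} = card T"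
      by (simp add: E_deg card_image)
    have loss: "(v + s) mod m = m - 1 \<longleftrightarrow> v = m - 1 - s" if "s \<in> S" for s
    proof
      assume "v = m - 1 - s" then show "(v + s) mod m = m - 1" using less[OF that] m by simp
    next
      assume *: "(v + s) mod m = m - 1"
      then have "(v + s) mod m = (m - 1) mod m"
        using m by simp
      then have "v + s = m - 1"
        by (rule mod_eq_imp_eq_nat) (use less[OF that] m True in linarith)+
      then show "v = m - 1 - s" by linarith
    qed
    have fin_E: "finite {e \<in> E. v \<in> e}"
      using fin by (simp add: E_deg T_def)
    have split: "{e \<in> E \<union> M. v \<in> e} = {e \<in> E. v \<in> e} \<union> {e \<in> M. v \<in> e}" by auto
    have disj: "{e \<in> E. v \<in> e} \<inter> {e \<in> M. v \<in> e} = {}"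
      using E_bip M D_sub by (fastforce simp: Y_def)
    show ?thesis
    proof (cases "v \<in> D")
      case True
      then obtain s where s: "s \<in> S" "v = m - 1 - s" by (auto simp: D_def)
      \<comment> \<open>A vertex of \<open>D\<close> loses exactly one edge, and its one edge in
        \<open>M\<close> makes up for it.\<close>
      have "T = S - {s}"
        using s loss inj by (auto simp: T_def inj_on_def)
      then have T: "card T + 1 = card S"
        using fin s card_Suc_Diff1[of S s] by simp
      obtain e where "{e \<in> M. v \<in> e} = {e}"
        using M_unique[OF True] by auto
      then show ?thesis
        using T E_card fin_E disj unfolding degree_def split by (subst card_Un_disjoint) auto
    next
      case False
      have "T = S" using False loss by (auto simp: T_def D_def)
      moreover have "{e \<in> M. v \<in> e} = {}" using M False by blast
      ultimately show ?thesis unfolding degree_def split by (simp only: E_card Un_empty_right)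
    qed
  next
    case False
    then have vY: "v \<in> Y" using v by (simp add: Y_def)
    \<comment> \<open>The neighbour of \<open>v\<close> along shift \<open>s\<close>; adding
      \<open>m - s\<close> avoids truncated subtraction of \<open>s\<close>.\<close>
    define f where "f s = (v - m + (m - s)) mod m" for s
    have f: "(f s + s) mod m = v - m" if "s \<in> S" for s
    proof -
      have "(f s + s) mod m = (v - m + (m - s) + s) mod m"
        by (simp add: f_def mod_add_left_eq)
      also have "v - m + (m - s) + s = v - m + m"
        using less[OF that] m by simp
      also have "(v - m + m) mod m = v - m"
        using v m by simp
      finally show ?thesis .
    qed
    have f_less: "f s < m" for s using m by (simp add: f_def)
    have eq_f: "x = f s" if "s \<in> S" "x < m" "(x + s) mod m = v - m" for x s
    proof -
      have "(x + s) mod m = (f s + s) mod m"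
        using f[OF that(1)] that(3) by simp
      then have "x + s = f s + s"
        by (rule mod_eq_imp_eq_nat) (use f_less[of s] that in linarith)+
      then show ?thesis by simp
    qed
    have "v \<notin> e" if "e \<in> M" for e
      using M[OF that] D_sub False by auto
    then have "{e \<in> E \<union> M. v \<in> e} = {e \<in> E. v \<in> e}" by auto
    also have "\<dots> = (\<lambda>s. {f s, v}) ` S" (is "?L = ?R")
    proof
      show "?L \<subseteq> ?R"
      proof
        fix e assume "e \<in> ?L"
        then obtain x s where "x < m" "s \<in> S" "(x + s) mod m = v - m" "e = {x, v}"
          using False by (auto simp: E_def)
        then show "e \<in> ?R" using eq_f by auto
      qed
      show "?R \<subseteq> ?L"
        using E_iff[OF f_less vY] f by auto
    qed
    finally have "{e \<in> E \<union> M. v \<in> e} = (\<lambda>s. {f s, v}) ` S" .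
    moreover have "inj_on (\<lambda>s. {f s, v}) S"
    proof (rule inj_onI)
      fix s t assume st: "s \<in> S" "t \<in> S" "{f s, v} = {f t, v}"
      then have "f s = f t" by (auto simp: doubleton_eq_iff)
      then have "(f s + s) mod m = (f s + t) mod m"
        using f[OF st(1)] f[OF st(2)] by simp
      then show "s = t" by (rule shift_inj[OF st(1,2)])
    qed
    ultimately show ?thesis by (simp add: degree_def card_image)
  qed
  ultimately show ?thesis by (auto simp: regular_graph_def)
qed

section \<open>Primes in short intervals\<close>

definition psi :: "nat \<Rightarrow> real" where
  "psi n = (\<Sum>d=1..n. mangoldt d)"

lemma psi_mono: "m \<le> n \<Longrightarrow> psi m \<le> psi n"
  unfolding psi_def by (intro sum_mono2) (auto intro: mangoldt_nonneg)

lemma psi_diff: "m \<le> n \<Longrightarrow> psi n - psi m = (\<Sum>d\<in>{m<..n}. mangoldt d)"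
  unfolding psi_def by (subst sum_diff [symmetric]) (auto intro!: sum.cong)

text \<open>From \<open>n\<close> to \<open>n + 1\<close> the quotient by \<open>d\<close> grows, by
  one, exactly when \<open>d\<close> divides \<open>n + 1\<close>; the values of
  \<open>mangoldt\<close> at these divisors sum to \<open>ln (n + 1)\<close>.\<close>

lemma ln_fact_eq_sum_mangoldt: "ln (fact n) = (\<Sum>d=1..n. mangoldt d * real (n div d))"
proof (induction n)
  case (Suc n)
  have step: "Suc n div d = n div d + (if d dvd Suc n then 1 else 0)" for d
    by (simp add: div_Suc dvd_eq_mod_eq_0)
  have "(\<Sum>d=1..Suc n. mangoldt d * real (Suc n div d)) =
      (\<Sum>d=1..Suc n. mangoldt d * real (n div d)) +
      (\<Sum>d=1..Suc n. if d dvd Suc n then mangoldt d else 0)"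
    unfolding sum.distrib [symmetric] by (intro sum.cong refl) (simp add: step algebra_simps)
  also have "(\<Sum>d=1..Suc n. mangoldt d * real (n div d)) = ln (fact n)"
    using Suc.IH by simp
  also have "(\<Sum>d=1..Suc n. if d dvd Suc n then mangoldt d else 0) = (\<Sum>d | d dvd Suc n. mangoldt d :: real)"
    by (subst sum.inter_filter [symmetric])
      (auto intro!: sum.cong simp: Suc_le_eq dest: dvd_imp_le intro: Nat.gr0I)
  also have "\<dots> = ln (real (Suc n))"
    using mangoldt_sum[of "Suc n", where 'a = real] by simp
  finally show ?case
    by (simp add: ln_mult)
qed simp

lemma ln_fact_eq_sum_mangoldt_atMost:
  assumes "n \<le> N"
  shows "ln (fact n) = (\<Sum>d=1..N. mangoldt d * real (n div d))"
  unfolding ln_fact_eq_sum_mangoldt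
  by (intro sum.mono_neutral_left) (use assms in auto)

lemma ln_fact_ge: "real n * ln n - n \<le> ln (fact n)"
proof (induction n)
  case (Suc n)
  show ?case
  proof (cases "n = 0")
    case False
    have "ln (1 + 1 / real n) \<le> 1 / real n"
      by (rule ln_add_one_self_le_self) simp
    also have "1 + 1 / real n = real (Suc n) / real n"
      using False by (simp add: field_simps)
    finally have "real n * (ln (Suc n) - ln n) \<le> 1"
      using False by (simp add: ln_div field_simps)
    then show ?thesis
      using Suc.IH unfolding fact_Suc of_nat_mult
      by (subst ln_mult) (simp_all add: algebra_simps)
  qed simp
qed simp

lemma ln_fact_le: "ln (fact n) \<le> real n * ln n - n + ln n + 1"
proof (induction n)
  case (Suc n)
  show ?case
  proof (cases "n = 0")
    case False
    have "ln (real n / real (Suc n)) \<le> real n / real (Suc n) - 1"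
      using False by (intro ln_le_minus_one) simp
    also have "\<dots> = - 1 / real (Suc n)"
      by (simp add: field_simps)
    finally have "real (Suc n) * (ln (Suc n) - ln n) \<ge> 1"
      using False by (simp add: ln_div field_simps)
    then show ?thesis
      using Suc.IH unfolding fact_Suc of_nat_mult
      by (subst ln_mult) (simp_all add: algebra_simps)
  qed simp
\<comment> \<open>At zero the bound rests on the default value \<open>ln 0 = 0\<close>.\<close>
qed simp

section \<open>Chebyshev's bounds for \<open>psi\<close>\<close>

text \<open>Since 30 + 1 = 15 + 10 + 6, the contribution of multiples of 30 cancels, and the first
  two claims reduce to a check of the residues modulo 30.\<close>

lemma chebyshev_floor_identity:
  fixes q :: nat
  shows "q div 2 + q div 3 + q div 5 \<le> q + q div 30"
    and "q + q div 30 \<le> q div 2 + q div 3 + q div 5 + 1"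
    and "0 < q \<Longrightarrow> q < 6 \<Longrightarrow> q + q div 30 = q div 2 + q div 3 + q div 5 + 1"
proof -
  define a r where "a = q div 30" and "r = q mod 30"
  have q: "q = 30 * a + r" and r: "r < 30"
    by (simp_all add: a_def r_def)
  have d: "q div 2 = 15 * a + r div 2" "q div 3 = 10 * a + r div 3"
    "q div 5 = 6 * a + r div 5" "q div 30 = a"
    unfolding q using r by auto
  have "r \<in> set [0..<30]" using r by simp
  then have "r div 2 + r div 3 + r div 5 \<le> r \<and> r \<le> r div 2 + r div 3 + r div 5 + 1"
    by (simp add: upt_rec) (elim disjE; simp)
  then show "q div 2 + q div 3 + q div 5 \<le> q + q div 30"
    and "q + q div 30 \<le> q div 2 + q div 3 + q div 5 + 1"
    unfolding d unfolding q by linarith+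
next
  assume "0 < q" "q < 6"
  then have "q \<in> {1, 2, 3, 4, 5}" by auto
  then show "q + q div 30 = q div 2 + q div 3 + q div 5 + 1" by auto
qed

text \<open>Thirty times Chebyshev's constant \<open>0.92129...\<close>\<close>

definition cheb_const :: real where
  "cheb_const = 30 * ln 30 - 15 * ln 15 - 10 * ln 10 - 6 * ln 6"

text \<open>Factoring the arguments gives
  \<open>cheb_const = 14 * ln 2 + 9 * ln 3 + 5 * ln 5\<close>.\<close>

lemma cheb_const_pos: "cheb_const > 0"
proof -
  have "ln 30 = ln 2 + (ln 15 :: real)" "ln 30 = ln 3 + (ln 10 :: real)"
    "ln 30 = ln 5 + (ln 6 :: real)" "ln 15 = ln 3 + (ln 5 :: real)"
    using ln_mult[of 2 "15::real"] ln_mult[of 3 "10::real"] ln_mult[of 5 "6::real"]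
      ln_mult[of 3 "5::real"] by simp_all
  moreover have "ln 2 > (0 :: real)" "ln 3 > (0 :: real)" "ln 5 > (0 :: real)" by simp_all
  ultimately show ?thesis unfolding cheb_const_def by linarith
qed

text \<open>The logarithm of Chebyshev's factorial ratio
  \<open>(30a)! a! / ((15a)! (10a)! (6a)!)\<close>.\<close>

definition cheb_sum :: "nat \<Rightarrow> real" where
  "cheb_sum a = ln (fact (30 * a)) + ln (fact a)
    - ln (fact (15 * a)) - ln (fact (10 * a)) - ln (fact (6 * a))"

text \<open>By 30 + 1 = 15 + 10 + 6 the terms in \<open>a * ln a\<close> and the linear Stirling
  terms cancel. Each Stirling error lies between 0 and \<open>ln n + 1\<close>; two enter positively
  and three negatively, whence the factor 3.\<close>

lemma cheb_sum_bounds: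
  assumes "a > 0"
  shows "\<bar>cheb_sum a - cheb_const * a\<bar> \<le> 3 * ln (real (30 * a)) + 3"
proof -
  have l: "ln (real (30 * a)) = ln 30 + ln a" "ln (real (15 * a)) = ln 15 + ln a"
    "ln (real (10 * a)) = ln 10 + ln a" "ln (real (6 * a)) = ln 6 + ln a"
    using assms by (simp_all add: ln_mult)
  have ln: "ln (real a) \<ge> 0" "ln 15 \<le> (ln 30 :: real)" "ln 10 \<le> (ln 30 :: real)"
    "ln 6 \<le> (ln 30 :: real)" "ln 30 \<ge> (0::real)"
    using assms by simp_all
  show ?thesis
    using ln_fact_ge[of "30 * a"] ln_fact_le[of "30 * a"] ln_fact_ge[of "15 * a"] ln_fact_le[of "15 * a"]
      ln_fact_ge[of "10 * a"] ln_fact_le[of "10 * a"] ln_fact_ge[of "6 * a"] ln_fact_le[of "6 * a"]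
      ln_fact_ge[of a] ln_fact_le[of a]
    unfolding l cheb_sum_def cheb_const_def abs_le_iff
    by (simp add: algebra_simps) (intro conjI; (use ln in linarith))
qed

text \<open>Iterated division makes the coefficient of \<open>mangoldt d\<close> a function of
  \<open>30 * a div d\<close> alone, to which the floor identity applies.\<close>

lemma cheb_sum_eq:
  "cheb_sum a = (\<Sum>d=1..30*a. mangoldt d * (real (30 * a div d) + real (30 * a div d div 30)
     - real (30 * a div d div 2) - real (30 * a div d div 3) - real (30 * a div d div 5)))"
proof -
  have "30 * a div d div 30 = a div d" "30 * a div d div 2 = 15 * a div d"
    "30 * a div d div 3 = 10 * a div d" "30 * a div d div 5 = 6 * a div d" for d
    by (simp_all add: div_mult2_eq [symmetric] mult.commute[of d] div_mult2_eq)
  then show ?thesis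
    unfolding cheb_sum_def
    by (subst (1 2 3 4 5) ln_fact_eq_sum_mangoldt_atMost[of _ "30 * a"])
       (simp_all add: ring_distribs sum.distrib sum_subtractf)
qed

lemma cheb_sum_le_psi: "cheb_sum a \<le> psi (30 * a)"
  unfolding cheb_sum_eq psi_def
proof (intro sum_mono)
  fix d
  show "mangoldt d * (real (30 * a div d) + real (30 * a div d div 30)
     - real (30 * a div d div 2) - real (30 * a div d div 3) - real (30 * a div d div 5)) \<le> mangoldt d"
    using chebyshev_floor_identity(2)[of "30 * a div d"]
    by (intro mult_left_le) (auto intro: mangoldt_nonneg)
qed

text \<open>No coefficient is negative, and for \<open>5 * a < d \<le> 30 * a\<close> the quotient
  lies between 1 and 5, where the coefficient is 1.\<close>

lemma psi_diff_le_cheb_sum: "psi (30 * a) - psi (5 * a) \<le> cheb_sum a"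
proof -
  let ?c = "\<lambda>d. real (30 * a div d) + real (30 * a div d div 30)
     - real (30 * a div d div 2) - real (30 * a div d div 3) - real (30 * a div d div 5)"
  have "psi (30 * a) - psi (5 * a) = (\<Sum>d\<in>{5*a<..30*a}. mangoldt d)"
    by (rule psi_diff) simp
  also have "\<dots> = (\<Sum>d\<in>{5*a<..30*a}. mangoldt d * ?c d)"
  proof (intro sum.cong refl)
    fix d assume d: "d \<in> {5*a<..30*a}"
    have "0 < 30 * a div d" using d by (simp add: div_greater_zero_iff)
    moreover have "30 * a div d < 6" using d by (simp add: div_less_iff_less_mult)
    ultimately have "?c d = 1"
      using chebyshev_floor_identity(3)[of "30 * a div d"] by linarith
    then show "mangoldt d = mangoldt d * ?c d" by simp
  qed
  also have "\<dots> \<le> (\<Sum>d=1..30*a. mangoldt d * ?c d)"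
  proof (intro sum_mono2)
    fix d
    show "0 \<le> mangoldt d * ?c d"
      using chebyshev_floor_identity(1)[of "30 * a div d"]
      by (intro mult_nonneg_nonneg mangoldt_nonneg) linarith
  qed auto
  finally show ?thesis by (simp add: cheb_sum_eq)
qed

lemma psi_lower:
  assumes "n \<ge> 30"
  shows "psi n \<ge> cheb_const / 30 * (real n - 30) - 3 * ln n - 3"
proof -
  define a where "a = n div 30"
  have a: "a > 0" "30 * a \<le> n" "n \<le> 30 * a + 30"
    using assms unfolding a_def by (auto simp: div_greater_zero_iff)
  have "cheb_const / 30 * (real n - 30) \<le> cheb_const / 30 * (30 * a)"
    using a(3) cheb_const_pos by (intro mult_left_mono) linarith+
  then have "cheb_const / 30 * (real n - 30) \<le> cheb_const * a" by simp
  moreover have "ln (30 * a) \<le> ln n" using a by simp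
  moreover have "\<bar>cheb_sum a - cheb_const * a\<bar> \<le> 3 * ln (30 * a) + 3"
    using cheb_sum_bounds a(1) by simp
  moreover have "cheb_sum a \<le> psi n"
    using cheb_sum_le_psi[of a] psi_mono[OF a(2)] by linarith
  ultimately show ?thesis by linarith
qed

text \<open>\<open>101 / 2500\<close> is \<open>6/5 * 1/30\<close> enlarged by one percent, which leaves room for the error terms
  in the induction and keeps the ratio to the lower bound at \<open>1.212\<close>, below \<open>61 / 50\<close>.\<close>

lemma psi_upper:
  obtains K where "\<And>n. psi n \<le> 101 / 2500 * cheb_const * n + K"
proof -
  define B where "B = 101 / 2500 * cheb_const"
  have B: "B > 0" using cheb_const_pos by (simp add: B_def)
  \<comment> \<open>One percent of \<open>cheb_const * a\<close> absorbs the logarithmic error and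
    the cost \<open>30 * B\<close> of rounding \<open>n\<close> up to a multiple of 30. The
    induction closes because \<open>25 * B = 101 / 100 * cheb_const\<close>.\<close>
  have "\<forall>\<^sub>F a in at_top. 3 * ln (30 * real a) + 3 + 30 * B \<le> cheb_const / 100 * real a"
    using cheb_const_pos by real_asymp
  then obtain a0 where a0: "\<And>a. a \<ge> a0 \<Longrightarrow> 3 * ln (30 * real a) + 3 + 30 * B \<le> cheb_const / 100 * real a"
    by (auto simp: eventually_at_top_linorder)
  define K where "K = psi (30 * a0 + 30)"
  have "psi n \<le> B * n + K" for n
  proof (induction n rule: less_induct)
    case (less n)
    show ?case
    proof (cases "n \<le> 30 * a0 + 30")
      case True
      then have "psi n \<le> K" unfolding K_def by (rule psi_mono)
      moreover have "B * n \<ge> 0" using B by simp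
      ultimately show ?thesis by linarith
    next
      case False
      obtain q r where qr: "n = 30 * q + r" "r < 30"
        by (metis mult_div_mod_eq mod_less_divisor zero_less_numeral)
      define a where "a = q + 1"
      have a: "a > 0" "a \<ge> a0" "n \<le> 30 * a" "30 * a \<le> n + 30" "5 * a < n"
        using qr False by (auto simp: a_def)
      have "psi n \<le> psi (30 * a)" using a(3) by (rule psi_mono)
      also have "\<dots> \<le> psi (5 * a) + cheb_sum a" using psi_diff_le_cheb_sum[of a] by linarith
      also have "\<dots> \<le> B * (5 * a) + K + cheb_sum a" using less.IH[OF a(5)] by simp
      also have "cheb_sum a \<le> cheb_const * a + (3 * ln (30 * a) + 3)"
        using cheb_sum_bounds[OF a(1)] by linarith
      also have "3 * ln (30 * a) + 3 \<le> cheb_const / 100 * a - 30 * B"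
        using a0[OF a(2)] by simp
      also have "B * (5 * a) + K + (cheb_const * a + (cheb_const / 100 * a - 30 * B)) = B * (30 * real a - 30) + K"
        by (simp add: B_def field_simps)
      also have "B * (30 * real a - 30) \<le> B * n"
        using a(4) B by (intro mult_left_mono) linarith+
      finally show ?thesis by simp
    qed
  qed
  then show ?thesis using that unfolding B_def by blast
qed

section \<open>From bounds for \<open>psi\<close> to primes\<close>

text \<open>Only powers \<open>p ^ k\<close> with \<open>k \<ge> 2\<close> contribute; they have
  \<open>p \<le> sqrt x\<close> and \<open>k \<le> log 2 x\<close>, and each contributes at most
  \<open>ln x\<close>.\<close>

lemma psi_diff_no_primes:
  assumes no: "\<And>p. prime p \<Longrightarrow> \<not> (y < p \<and> p \<le> x)" and "y \<le> x" "x > 0"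
  shows "psi x - psi y \<le> (sqrt x + 1) * (log 2 x + 1) * ln x"
proof -
  let ?P = "{d \<in> {y<..x}. primepow d}"
  let ?R = "{..nat \<lfloor>sqrt x\<rfloor>} \<times> {..nat \<lfloor>log 2 x\<rfloor>}"
  have "?P \<subseteq> (\<lambda>(p, k). p ^ k) ` ?R"
  proof
    fix d assume d: "d \<in> ?P"
    then obtain p k where pk: "prime p" "k > 0" "d = p ^ k"
      by (auto simp: primepow_def)
    have "k \<noteq> 1" using no[of p] pk d by auto
    then have "k \<ge> 2" using pk by simp
    have p2: "p \<ge> 2" using pk(1) by (rule prime_ge_2_nat)
    have "p ^ 2 \<le> p ^ k" using \<open>k \<ge> 2\<close> p2 by (intro power_increasing) auto
    also have "\<dots> \<le> x" using d pk by simp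
    finally have "real p ^ 2 \<le> real x" by (simp flip: of_nat_power)
    then have "real p \<le> sqrt x" by (rule real_le_rsqrt)
    then have "p \<le> nat \<lfloor>sqrt x\<rfloor>" by (simp add: le_nat_floor)
    moreover have "2 ^ k \<le> p ^ k" using p2 by (intro power_mono) auto
    then have "2 ^ k \<le> x" using d pk(3) by (auto intro: order.trans)
    then have "real k \<le> log 2 x"
      using assms(3) by (simp add: le_log_of_power)
    then have "k \<le> nat \<lfloor>log 2 x\<rfloor>" by (simp add: le_nat_floor)
    ultimately show "d \<in> (\<lambda>(p, k). p ^ k) ` ?R" using pk(3) by auto
  qed
  then have "card ?P \<le> card ?R"
    by (meson card_image_le card_mono finite_SigmaI finite_atMost finite_imageI le_trans)
  also have "card ?R = (nat \<lfloor>sqrt x\<rfloor> + 1) * (nat \<lfloor>log 2 x\<rfloor> + 1)"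
    by (simp add: card_cartesian_product)
  finally have "real (card ?P) \<le> real ((nat \<lfloor>sqrt x\<rfloor> + 1) * (nat \<lfloor>log 2 x\<rfloor> + 1))"
    by (rule of_nat_mono)
  also have "\<dots> \<le> (sqrt x + 1) * (log 2 x + 1)"
    unfolding of_nat_mult of_nat_add using assms(3) by (intro mult_mono add_mono) auto
  finally have card: "real (card ?P) \<le> (sqrt x + 1) * (log 2 x + 1)" .
  have "psi x - psi y = (\<Sum>d\<in>{y<..x}. mangoldt d)"
    using \<open>y \<le> x\<close> by (rule psi_diff)
  also have "\<dots> = (\<Sum>d\<in>?P. mangoldt d)"
    by (intro sum.mono_neutral_right) (auto simp: mangoldt_def)
  also have "\<dots> \<le> (\<Sum>d\<in>?P. ln x)"
  proof (intro sum_mono)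
    fix d assume "d \<in> ?P"
    then have "d > 0" "d \<le> x" by auto
    then show "mangoldt d \<le> ln x"
      using mangoldt_le[of d] by (meson ln_mono of_nat_0_less_iff of_nat_le_iff order.trans)
  qed
  also have "\<dots> = real (card ?P) * ln x" by simp
  also have "\<dots> \<le> (sqrt x + 1) * (log 2 x + 1) * ln x"
    using card assms(3) by (intro mult_right_mono) auto
  finally show ?thesis .
qed

text \<open>The upper bound at \<open>50 / 61 * x\<close> has leading coefficient
  \<open>101 / 3050 * cheb_const\<close>, less than the \<open>cheb_const / 30\<close> of the lower
  bound at \<open>x\<close>. The linear gap exceeds what proper prime powers can supply.\<close>

theorem eventually_prime_in_short_interval:
  "\<forall>\<^sub>F x in at_top. \<exists>p::nat. prime p \<and> p \<le> x \<and> real x < 61 / 50 * real p"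
proof -
  obtain K where K: "\<And>n. psi n \<le> 101 / 2500 * cheb_const * n + K"
    using psi_upper by metis
  have "\<forall>\<^sub>F x::nat in at_top. cheb_const / 30 * (real x - 30) - 3 * ln x - 3
      > 101 / 3050 * cheb_const * real x + K + (sqrt x + 1) * (log 2 x + 1) * ln x"
    using cheb_const_pos unfolding log_def by real_asymp
  moreover have "\<forall>\<^sub>F x::nat in at_top. x \<ge> 30" by (rule eventually_ge_at_top)
  ultimately show ?thesis
  proof eventually_elim
    case (elim x)
    define y where "y = nat \<lfloor>50 / 61 * real x\<rfloor>"
    have y: "real y \<le> 50 / 61 * real x" "50 / 61 * real x < real y + 1" "y \<le> x"
      unfolding y_def by linarith+
    show ?case
    proof (rule ccontr)
      assume contra: "\<not> ?thesis"
      have "\<not> (y < p \<and> p \<le> x)" if "prime p" for p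
      proof
        assume "y < p \<and> p \<le> x"
        then have "real y + 1 \<le> real p" "p \<le> x" by auto
        then have "real x < 61 / 50 * real p" using y by simp
        with contra that \<open>p \<le> x\<close> show False by blast
      qed
      then have "psi x - psi y \<le> (sqrt x + 1) * (log 2 x + 1) * ln x"
        by (rule psi_diff_no_primes) (use y elim in auto)
      moreover have "psi y \<le> 101 / 3050 * cheb_const * real x + K"
      proof -
        have "101 / 2500 * cheb_const * real y \<le> 101 / 2500 * cheb_const * (50 / 61 * real x)"
          using y(1) cheb_const_pos by (intro mult_left_mono) auto
        then show ?thesis using K[of y] by simp
      qed
      moreover have "psi x \<ge> cheb_const / 30 * (real x - 30) - 3 * ln x - 3"
        using elim(2) by (rule psi_lower)
      ultimately show False using elim(1) by linarith
    qed
  qed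
qed

section \<open>Choice of parameters and conclusion\<close>

text \<open>\<open>4083 / 10000\<close> is a rational just above \<open>sqrt (1 / 6)\<close>, and
  the right side grows like \<open>25 / 61 * sqrt n\<close>, where \<open>25 / 61\<close> is about
  0.4098.\<close>

lemma eventually_degree_bound:
  "\<forall>\<^sub>F n :: nat in at_top. 4083 / 10000 * sqrt n \<le> 50 / 61 * (sqrt (real n - 1) / 2 - 1) - 1"
  by real_asymp

theorem theorem3p3:
  fixes \<epsilon> :: real
  assumes "0 < \<epsilon>" and "\<epsilon> < 1 / 100"
  shows "\<exists>n\<^sub>0 :: nat. \<forall>n :: nat. n > n\<^sub>0 \<longrightarrow> odd n \<longrightarrow>
    (\<exists>(V :: nat set) (E :: nat set set) (k :: nat).
        simple_graph V E \<and> card V = n \<and> \<not> contains_C4 E \<and>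
        regular_graph V E k \<and>
        real k \<ge> (sqrt (1 / 6) - \<epsilon>) * sqrt (real n))"
proof -
  obtain x0 where x0: "\<And>x. x \<ge> x0 \<Longrightarrow> \<exists>p::nat. prime p \<and> p \<le> x \<and> real x < 61 / 50 * real p"
    using eventually_prime_in_short_interval unfolding eventually_at_top_linorder by blast
  obtain n1 where n1: "\<And>n::nat. n \<ge> n1 \<Longrightarrow>
      4083 / 10000 * sqrt n \<le> 50 / 61 * (sqrt (real n - 1) / 2 - 1) - 1"
    using eventually_degree_bound unfolding eventually_at_top_linorder by blast
  \<comment> \<open>With \<open>x \<ge> 3\<close> the prime exceeds \<open>150 / 61 > 2\<close>, so
    it is odd and \<open>p - 1\<close> is even.\<close>
  define c where "c = max x0 3"
  have "\<exists>(V :: nat set) (E :: nat set set) (k :: nat).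
        simple_graph V E \<and> card V = n \<and> \<not> contains_C4 E \<and> regular_graph V E k \<and>
        real k \<ge> (sqrt (1 / 6) - \<epsilon>) * sqrt (real n)"
    if n: "n > max n1 (4 * c ^ 2)" and "odd n" for n
  proof -
    define m where "m = (n + 1) div 2"
    define N where "N = m div 2"
    \<comment> \<open>Any \<open>p \<le> x\<close> then has
      \<open>p * (p - 1) \<le> x * x \<le> N\<close>, so Ruzsa's set fits below
      \<open>N\<close>.\<close>
    define x where "x = nat \<lfloor>sqrt N\<rfloor>"
    have m: "n = 2 * m - 1" "m > 0" using \<open>odd n\<close> by (auto simp: m_def elim!: oddE)
    have "2 * N \<le> m" "m \<le> 2 * N + 1" "n + 1 = 2 * m" "n > 4 * c ^ 2"
      using m n unfolding N_def by simp_all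
    then have N: "n \<le> 4 * N + 1" "N \<ge> c ^ 2" "2 * N \<le> m"
      by - linarith+
    have "real n \<le> real (4 * N + 1)"
      using N(1) by (rule of_nat_mono)
    then have n_le: "(real n - 1) / 4 \<le> real N" by simp
    have "real c ^ 2 \<le> real N" using N(2) by (simp flip: of_nat_power)
    then have "real c \<le> sqrt N" by (rule real_le_rsqrt)
    then have x_ge: "x \<ge> c" by (simp add: x_def le_nat_floor)
    have x: "real x \<le> sqrt N" "sqrt N < real x + 1"
      unfolding x_def using real_sqrt_ge_zero[of N] by - linarith+
    obtain p where p: "prime p" "p \<le> x" "real x < 61 / 50 * real p"
      using x0[of x] x_ge by (auto simp: c_def)
    have "real p > 2" using p(3) x_ge by (simp add: c_def)
    then have "odd p" using p(1) prime_odd_nat by simp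
    obtain S where S: "sidon S" "card S = p - 1" "S \<subseteq> {..<p * (p - 1)}"
      using sidon_set_exists[OF p(1)] by blast
    have "real (x * x) \<le> real N"
      using mult_mono[OF x(1) x(1)] by simp
    then have "p * (p - 1) \<le> N"
      using mult_le_mono[OF p(2) order.trans[OF diff_le_self p(2)], of 1] by linarith
    then have "2 * (p * (p - 1)) \<le> m" using N(3) by linarith
    moreover have "even (card S)" using S(2) \<open>odd p\<close> by simp
    ultimately obtain E where E: "simple_graph {..<n} E" "\<not> contains_C4 E"
        "regular_graph {..<n} E (p - 1)"
      using sidon_odd_regular_graph[OF S(1,3) _ m(2)] unfolding S(2) m(1) by blast
    have "sqrt (1 / 6) \<le> 4083 / 10000"
      by (rule real_le_lsqrt) (simp_all add: power2_eq_square)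
    then have "(sqrt (1 / 6) - \<epsilon>) * sqrt n \<le> 4083 / 10000 * sqrt n"
      using assms(1) by (intro mult_right_mono) auto
    also have "\<dots> \<le> 50 / 61 * (sqrt (real n - 1) / 2 - 1) - 1"
      using n1[of n] n by simp
    also have "\<dots> \<le> 50 / 61 * (sqrt N - 1) - 1"
      using real_sqrt_le_mono[OF n_le] by (simp add: real_sqrt_divide)
    also have "\<dots> \<le> 50 / 61 * real x - 1"
      using x by simp
    also have "\<dots> \<le> real (p - 1)"
      using p(3) \<open>real p > 2\<close> by simp
    finally show ?thesis
      using E by (intro exI[of _ "{..<n}"] exI[of _ E] exI[of _ "p - 1"]) simp
  qed
  then show ?thesis by blast
qed

end
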